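(* Let $G$ be a finite directed graph on $n$ vertices with a global sink. The set of all recurrent chip configurations on $G$ is an abelian group under the operation $(\sigma,\sigma')\mapsto(\sigma+\sigma')^\circ$, and it is isomorphic, via the inclusion map (sending a recurrent configuration $\sigma\in\mathbb{Z}^{n-1}$ to its class), to the sandpile group $\mathcal{S}(G)=\mathbb{Z}^{n-1}/\mathbb{Z}^{n-1}\Delta'(G)$.
   Context: Directed graphs are finite; self-loops and multiple edges are allowed. A sink is a vertex of out-degree zero; a global sink is a sink $s$ such that from every other vertex there is a directed path leading to $s$. Let $d_v$ be the out-degree of $v$ and $a_{vw}$ the number of edges from $v$ to $w$. The reduced Laplacian $\Delta'=\Delta'(G)$ is the $(n-1)\times(n-1)$ matrix indexed by non-sink vertices with $\Delta'_{vw}=-a_{vw}$ for $v\ne w$ and $\Delta'_{vv}=d_v-a_{vv}$; $\mathbb{Z}^{n-1}\Delta'$ is its integer row span. A chip configuration is a vector $\sigma$ of non-negative integers indexed by the non-sink vertices. A non-sink vertex $v$ is active in $\sigma$ if $\sigma(v)\ge d_v$; an active vertex can fire, giving $\sigma'$ with $\sigma'(w)=\sigma(w)+a_{vw}$ for non-sink $w\neq v$ and $\sigma'(v)=\sigma(v)-d_v+a_{vv}$. A configuration is stable if no vertex is active. On a digraph with a global sink, every chip configuration $\sigma$ reaches, after finitely many firings of active vertices, a stable configuration, which does not depend on the order of firings; it is denoted $\sigma^\circ$. A chip configuration $\sigma$ is accessible if from any other chip configuration it is possible to obtain $\sigma$ by a combination of adding chips and selectively firing active vertices. A chip configuration that is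 both stable and accessible is called recurrent. *)

theory Defs
  imports
    "Graph_Theory.Digraph"
    "HOL-Algebra.Coset"
    "HOL-Algebra.Elementary_Groups"
    "HOL-Algebra.Product_Groups"
begin

definition sink :: "('a, 'b) pre_digraph \<Rightarrow> 'a \<Rightarrow> bool" where
  "sink G s \<longleftrightarrow> s \<in> verts G \<and> out_degree G s = 0"

definition global_sink :: "('a, 'b) pre_digraph \<Rightarrow> 'a \<Rightarrow> bool" where
  "global_sink G s \<longleftrightarrow> sink G s \<and> (\<forall>v \<in> verts G - {s}. v \<rightarrow>\<^sup>*\<^bsub>G\<^esub> s)"

definition nonsinks :: "('a, 'b) pre_digraph \<Rightarrow> 'a set" where
  "nonsinks G = {v \<in> verts G. \<not> sink G v}"

definition edge_mult :: "('a, 'b) pre_digraph \<Rightarrow> 'a \<Rightarrow> 'a \<Rightarrow> nat" where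
  "edge_mult G v w = card {e \<in> arcs G. tail G e = v \<and> head G e = w}"

definition reduced_laplacian :: "('a, 'b) pre_digraph \<Rightarrow> 'a \<Rightarrow> 'a \<Rightarrow> int" where
  "reduced_laplacian G v w =
     (if v = w then int (out_degree G v) - int (edge_mult G v v) else - int (edge_mult G v w))"

text \<open>
  Vectors indexed by the non-sink vertices are functions that are \<^const>\<open>undefined\<close> off
  \<^term>\<open>nonsinks G\<close>, as in \<^const>\<open>product_group\<close>. If the graph has a global sink, then this is
  its only sink, so for \<open>n\<close> vertices the following group is \<open>\<int>\<close> to the power \<open>n - 1\<close>.
\<close>

definition int_vectors :: "('a, 'b) pre_digraph \<Rightarrow> ('a \<Rightarrow> int) monoid" where
  "int_vectors G = product_group (nonsinks G) (\<lambda>_. integer_group)"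

definition laplacian_row_span :: "('a, 'b) pre_digraph \<Rightarrow> ('a \<Rightarrow> int) set" where
  "laplacian_row_span G =
     range (\<lambda>c :: 'a \<Rightarrow> int.
       \<lambda>w \<in> nonsinks G. \<Sum>v \<in> nonsinks G. c v * reduced_laplacian G v w)"

lemma laplacian_row_span_normal: "laplacian_row_span G \<lhd> int_vectors G"
proof -
  have grp: "group (int_vectors G)"
    unfolding int_vectors_def by simp
  have comm: "comm_group (int_vectors G)"
    by (intro group.group_comm_groupI[OF grp])
       (auto simp: int_vectors_def integer_group_def intro!: restrict_ext)
  let ?row = "\<lambda>c :: 'a \<Rightarrow> int.
    \<lambda>w \<in> nonsinks G. \<Sum>v \<in> nonsinks G. c v * reduced_laplacian G v w"
  have add: "?row c \<otimes>\<^bsub>int_vectors G\<^esub> ?row d = ?row (\<lambda>v. c v + d v)" for c d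
    by (auto simp: int_vectors_def integer_group_def distrib_right sum.distrib intro!: restrict_ext)
  have neg: "inv\<^bsub>int_vectors G\<^esub> (?row c) = ?row (\<lambda>v. - c v)" for c
  proof (rule group.inv_equality[OF grp])
    show "?row (\<lambda>v. - c v) \<otimes>\<^bsub>int_vectors G\<^esub> ?row c = \<one>\<^bsub>int_vectors G\<^esub>"
      unfolding add by (auto simp: int_vectors_def integer_group_def)
  qed (auto simp: int_vectors_def integer_group_def)
  have "subgroup (laplacian_row_span G) (int_vectors G)"
  proof (rule group.subgroupI[OF grp])
    show "laplacian_row_span G \<subseteq> carrier (int_vectors G)"
      by (auto simp: laplacian_row_span_def int_vectors_def integer_group_def)
    show "laplacian_row_span G \<noteq> {}"
      by (simp add: laplacian_row_span_def)
    show "inv\<^bsub>int_vectors G\<^esub> x \<in> laplacian_row_span G" if "x \<in> laplacian_row_span G" for x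
    proof -
      from that obtain c where "x = ?row c"
        unfolding laplacian_row_span_def by (elim rangeE)
      then show ?thesis
        unfolding laplacian_row_span_def by (simp only: neg) (rule rangeI)
    qed
    show "x \<otimes>\<^bsub>int_vectors G\<^esub> y \<in> laplacian_row_span G"
      if "x \<in> laplacian_row_span G" "y \<in> laplacian_row_span G" for x y
    proof -
      from that obtain c d where "x = ?row c" "y = ?row d"
        unfolding laplacian_row_span_def by (elim rangeE)
      then show ?thesis
        unfolding laplacian_row_span_def by (simp only: add) (rule rangeI)
    qed
  qed
  then show ?thesis
    by (rule comm_group.subgroup_imp_normal[OF comm])
qed

definition sandpile_group :: "('a, 'b) pre_digraph \<Rightarrow> ('a \<Rightarrow> int) set monoid" where
  "sandpile_group G = int_vectors G Mod laplacian_row_span G"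

text \<open>
  Chip configurations are integer vectors with non-negative entries, so that the inclusion of
  the recurrent configurations into the integer vectors is the identity function.
\<close>

definition chip_configs :: "('a, 'b) pre_digraph \<Rightarrow> ('a \<Rightarrow> int) set" where
  "chip_configs G = (\<Pi>\<^sub>E v \<in> nonsinks G. {0..})"

definition add_configs ::
    "('a, 'b) pre_digraph \<Rightarrow> ('a \<Rightarrow> int) \<Rightarrow> ('a \<Rightarrow> int) \<Rightarrow> 'a \<Rightarrow> int" where
  "add_configs G \<sigma> \<tau> = (\<lambda>v \<in> nonsinks G. \<sigma> v + \<tau> v)"

definition active :: "('a, 'b) pre_digraph \<Rightarrow> ('a \<Rightarrow> int) \<Rightarrow> 'a \<Rightarrow> bool" where
  "active G \<sigma> v \<longleftrightarrow> v \<in> nonsinks G \<and> int (out_degree G v) \<le> \<sigma> v"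

definition fire :: "('a, 'b) pre_digraph \<Rightarrow> 'a \<Rightarrow> ('a \<Rightarrow> int) \<Rightarrow> 'a \<Rightarrow> int" where
  "fire G v \<sigma> = (\<lambda>w \<in> nonsinks G.
     if w = v then \<sigma> v - int (out_degree G v) + int (edge_mult G v v)
     else \<sigma> w + int (edge_mult G v w))"

definition firing_step :: "('a, 'b) pre_digraph \<Rightarrow> ('a \<Rightarrow> int) \<Rightarrow> ('a \<Rightarrow> int) \<Rightarrow> bool" where
  "firing_step G \<sigma> \<sigma>' \<longleftrightarrow> (\<exists>v. active G \<sigma> v \<and> \<sigma>' = fire G v \<sigma>)"

definition adding_step :: "('a, 'b) pre_digraph \<Rightarrow> ('a \<Rightarrow> int) \<Rightarrow> ('a \<Rightarrow> int) \<Rightarrow> bool" where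
  "adding_step G \<sigma> \<sigma>' \<longleftrightarrow> (\<exists>\<tau> \<in> chip_configs G. \<sigma>' = add_configs G \<sigma> \<tau>)"

definition stable :: "('a, 'b) pre_digraph \<Rightarrow> ('a \<Rightarrow> int) \<Rightarrow> bool" where
  "stable G \<sigma> \<longleftrightarrow> (\<forall>v. \<not> active G \<sigma> v)"

text \<open>
  The description below determines a unique configuration when \<open>G\<close> is finite with a global
  sink and \<open>\<sigma>\<close> is a chip configuration.
\<close>

definition stabilization :: "('a, 'b) pre_digraph \<Rightarrow> ('a \<Rightarrow> int) \<Rightarrow> 'a \<Rightarrow> int" where
  "stabilization G \<sigma> = (THE \<tau>. (firing_step G)\<^sup>*\<^sup>* \<sigma> \<tau> \<and> stable G \<tau>)"

definition accessible :: "('a, 'b) pre_digraph \<Rightarrow> ('a \<Rightarrow> int) \<Rightarrow> bool" where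
  "accessible G \<sigma> \<longleftrightarrow>
     (\<forall>\<tau> \<in> chip_configs G - {\<sigma>}. (\<lambda>\<rho> \<rho>'. adding_step G \<rho> \<rho>' \<or> firing_step G \<rho> \<rho>')\<^sup>*\<^sup>* \<tau> \<sigma>)"

definition recurrent_configs :: "('a, 'b) pre_digraph \<Rightarrow> ('a \<Rightarrow> int) set" where
  "recurrent_configs G = {\<sigma> \<in> chip_configs G. stable G \<sigma> \<and> accessible G \<sigma>}"

definition recurrent_mult ::
    "('a, 'b) pre_digraph \<Rightarrow> ('a \<Rightarrow> int) \<Rightarrow> ('a \<Rightarrow> int) \<Rightarrow> 'a \<Rightarrow> int" where
  "recurrent_mult G \<sigma> \<tau> = stabilization G (add_configs G \<sigma> \<tau>)"

text \<open>
  A monoid record needs a neutral element, which has no simple formula here; it is described as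
  the two-sided neutral element of the operation, of which there is at most one.
\<close>

definition recurrent_group :: "('a, 'b) pre_digraph \<Rightarrow> ('a \<Rightarrow> int) monoid" where
  "recurrent_group G =
     \<lparr>carrier = recurrent_configs G,
      monoid.mult = recurrent_mult G,
      one = (THE \<epsilon>. \<epsilon> \<in> recurrent_configs G \<and>
        (\<forall>\<sigma> \<in> recurrent_configs G. recurrent_mult G \<epsilon> \<sigma> = \<sigma> \<and> recurrent_mult G \<sigma> \<epsilon> = \<sigma>))\<rparr>"

end

theory Submission
  imports Defs
begin

text \<open>
  A weight function on the vertices that decreases under every firing gives termination, and two
  active vertices can be fired in either order, so stabilizations exist and are unique. Hence
  \<open>(\<sigma>\<degree> + \<tau>)\<degree> = (\<sigma> + \<tau>)\<degree>\<close>, and the recurrent configurations are exactly the \<open>\<rho>\<degree>\<close> for which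
  \<open>\<rho>\<close> dominates the largest stable configuration. The vector \<open>\<epsilon> = \<delta> - \<delta>\<degree>\<close> with \<open>\<delta>(v) = d\<^sub>v\<close>
  lies in the row span and has strictly positive entries. Adding a large multiple of it to an
  integer vector and stabilizing yields a recurrent configuration in every class. For recurrent
  \<open>\<sigma>\<close> one has \<open>(\<sigma> + k\<epsilon>)\<degree> = \<sigma>\<close>; if \<open>\<sigma>\<close> and \<open>\<tau>\<close> are recurrent and \<open>\<sigma> - \<tau> = c\<Delta>'\<close>, then for large
  \<open>k\<close> both \<open>\<sigma> + k\<epsilon>\<close> (firing along \<open>c\<^sup>+\<close>) and \<open>\<tau> + k\<epsilon>\<close> (firing along \<open>c\<^sup>-\<close>) reach the same
  configuration, so \<open>\<sigma> = \<tau>\<close>.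
\<close>

locale sandpile = fin_digraph G for G :: "('a, 'b) pre_digraph" (structure) +
  fixes s :: 'a
  assumes global_sink: "global_sink G s"
begin

abbreviation L :: "'a \<Rightarrow> 'a \<Rightarrow> int" where
  "L \<equiv> reduced_laplacian G"

abbreviation row :: "('a \<Rightarrow> int) \<Rightarrow> 'a \<Rightarrow> int" where
  "row c w \<equiv> \<Sum>v\<in>nonsinks G. c v * L v w"

abbreviation fires :: "('a \<Rightarrow> int) \<Rightarrow> ('a \<Rightarrow> int) \<Rightarrow> bool" where
  "fires \<equiv> (firing_step G)\<^sup>*\<^sup>*"

abbreviation stab :: "('a \<Rightarrow> int) \<Rightarrow> 'a \<Rightarrow> int" where
  "stab \<equiv> stabilization G"

section \<open>The sink and a weight function\<close>

lemma finite_nonsinks [simp]: "finite (nonsinks G)"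
  by (simp add: nonsinks_def)

text \<open>A second sink would have no outgoing edge, so the path from it to \<open>s\<close> could
  not take its first step.\<close>

lemma nonsinks_eq: "nonsinks G = verts G - {s}"
proof -
  have "\<not> sink G v" if v: "v \<in> verts G" "v \<noteq> s" for v
  proof
    assume "sink G v"
    then have "out_arcs G v = {}"
      using finite_out_arcs[of v] by (simp add: sink_def out_degree_def card_eq_0_iff)
    then have *: "\<not> v \<rightarrow>\<^bsub>G\<^esub> w" for w
      by (auto simp: out_arcs_def arcs_ends_def arc_to_ends_def)
    have "v \<rightarrow>\<^sup>*\<^bsub>G\<^esub> s"
      using v global_sink by (auto simp: global_sink_def)
    then show False
      using * v by (cases rule: converse_reachable_cases) auto
  qed
  then show ?thesis
    using global_sink by (auto simp: nonsinks_def global_sink_def)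
qed

lemma sum_edge_mult: "(\<Sum>w\<in>verts G. edge_mult G v w) = out_degree G v"
proof -
  have "out_degree G v = card (\<Union>w\<in>verts G. {e \<in> arcs G. tail G e = v \<and> head G e = w})"
    unfolding out_degree_def by (intro arg_cong[where f = card]) auto
  also have "\<dots> = (\<Sum>w\<in>verts G. edge_mult G v w)"
    unfolding edge_mult_def by (subst card_UN_disjoint) auto
  finally show ?thesis ..
qed

text \<open>
  The weight of \<open>v\<close> is \<open>M ^ D - M ^ (D - dist v)\<close> with \<open>M\<close> larger than all out-degrees, so that
  the gain along one edge that decreases the distance to the sink outweighs the loss along all
  the other edges.
\<close>

lemma weight_exists:
  "\<exists>h :: 'a \<Rightarrow> int. (\<forall>v. 0 \<le> h v) \<and> (\<forall>v\<in>nonsinks G. 1 \<le> (\<Sum>w\<in>nonsinks G. L v w * h w))"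
proof -
  define R where "R = arcs_ends G"
  define dist where "dist v = (LEAST k. (v, s) \<in> R ^^ k)" for v
  \<comment> \<open>Any common bound on the distances would do; it keeps the natural-number
    exponents \<open>D - dist v\<close> of vertices from being cut off at 0.\<close>
  define D where "D = (\<Sum>v\<in>verts G. dist v)"
  define M :: int where "M = 1 + (\<Sum>v\<in>verts G. int (out_degree G v))"
  define h where "h v = M ^ D - M ^ (D - dist v)" for v
  have M1: "1 \<le> M"
    unfolding M_def by (simp add: sum_nonneg)
  have h0: "0 \<le> h v" for v
    unfolding h_def using M1 by (simp add: power_increasing)
  have distD: "dist v \<le> D" if "v \<in> verts G" for v
    unfolding D_def using that by (intro member_le_sum) auto
  have degM: "int (out_degree G v) < M" if "v \<in> verts G" for v
    unfolding M_def
    using member_le_sum[of v "verts G" "\<lambda>v. int (out_degree G v)"] that by simp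
  have "1 \<le> (\<Sum>w\<in>nonsinks G. L v w * h w)" if v: "v \<in> nonsinks G" for v
  proof -
    have vv: "v \<in> verts G" and vs: "v \<noteq> s"
      using v by (auto simp: nonsinks_eq)
    have "v \<rightarrow>\<^sup>*\<^bsub>G\<^esub> s"
      using vv vs global_sink by (auto simp: global_sink_def)
    then have "(v, s) \<in> R\<^sup>*"
      unfolding R_def reachable_def by (rule rtrancl_on_rtranclI)
    then have "\<exists>k. (v, s) \<in> R ^^ k"
      by (simp add: rtrancl_power)
    then have dv: "(v, s) \<in> R ^^ dist v"
      unfolding dist_def by (rule LeastI_ex)
    with vs obtain k where k: "dist v = Suc k"
      by (cases "dist v") auto
    with dv obtain u where u: "(v, u) \<in> R" "(u, s) \<in> R ^^ k"
      by (metis relpow_Suc_D2)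
    have uk: "dist u \<le> k"
      unfolding dist_def using u(2) by (rule Least_le)
    have uv: "u \<in> verts G"
      using u(1) unfolding R_def by (rule adj_in_verts)
    have "{e \<in> arcs G. tail G e = v \<and> head G e = u} \<noteq> {}"
      using u(1) by (auto simp: R_def arcs_ends_def arc_to_ends_def)
    then have a1: "1 \<le> edge_mult G v u"
      unfolding edge_mult_def by (simp add: Suc_le_eq card_gt_0_iff)
    let ?d = "int (out_degree G v)" and ?a = "\<lambda>w. int (edge_mult G v w)"
    let ?e = "D - dist v"
    have deg: "(\<Sum>w\<in>verts G. ?a w) = ?d"
      by (simp flip: sum_edge_mult)
    have ke: "Suc ?e \<le> D - dist u"
      using distD[OF vv] uk k by linarith
    \<comment> \<open>The edges to \<open>u\<close>, which lies closer to the sink, already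
      contribute a power beyond \<open>M ^ ?e\<close>. This outweighs \<open>?d * M ^ ?e\<close>
      because \<open>?d < M\<close>.\<close>
    have "M ^ Suc ?e \<le> M ^ (D - dist u)"
      using M1 ke by (rule power_increasing[rotated])
    also have "\<dots> \<le> ?a u * M ^ (D - dist u)"
      using a1 M1 by (simp add: mult_le_cancel_right1)
    also have "\<dots> \<le> (\<Sum>w\<in>verts G. ?a w * M ^ (D - dist w))"
      using uv M1 by (intro member_le_sum) auto
    finally have low: "M ^ Suc ?e \<le> (\<Sum>w\<in>verts G. ?a w * M ^ (D - dist w))" .
    \<comment> \<open>Including the sink can only raise the sum, as \<open>h\<close> is
      non-negative; over all vertices the multiplicities add up to the out-degree.\<close>
    have "(\<Sum>w\<in>nonsinks G. ?a w * h w) \<le> (\<Sum>w\<in>verts G. ?a w * h w)"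
      using h0 by (intro sum_mono2) (auto simp: nonsinks_eq)
    also have "\<dots> = ?d * M ^ D - (\<Sum>w\<in>verts G. ?a w * M ^ (D - dist w))"
      unfolding h_def by (simp add: right_diff_distrib sum_subtractf flip: deg sum_distrib_right)
    finally have up: "(\<Sum>w\<in>nonsinks G. ?a w * h w) \<le> ?d * M ^ D - M ^ Suc ?e"
      using low by linarith
    have "(\<Sum>w\<in>nonsinks G. L v w * h w)
        = (\<Sum>w\<in>nonsinks G. (if w = v then ?d * h v else 0) - ?a w * h w)"
      by (intro sum.cong) (auto simp: reduced_laplacian_def left_diff_distrib)
    also have "\<dots> = ?d * h v - (\<Sum>w\<in>nonsinks G. ?a w * h w)"
      using v by (simp add: sum_subtractf)
    also have "\<dots> \<ge> ?d * h v - (?d * M ^ D - M ^ Suc ?e)"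
      using up by linarith
    also have "?d * h v - (?d * M ^ D - M ^ Suc ?e) = M ^ ?e * (M - ?d)"
      unfolding h_def by (simp add: algebra_simps)
    finally have ge: "M ^ ?e * (M - ?d) \<le> (\<Sum>w\<in>nonsinks G. L v w * h w)" .
    have "0 < M ^ ?e * (M - ?d)"
      using M1 degM[OF vv] by simp
    with ge show ?thesis
      by linarith
  qed
  with h0 show ?thesis
    by blast
qed

section \<open>Chip configurations, firing and adding chips\<close>

lemma chip_configs_iff:
  "\<sigma> \<in> chip_configs G \<longleftrightarrow> \<sigma> \<in> extensional (nonsinks G) \<and> (\<forall>v\<in>nonsinks G. 0 \<le> \<sigma> v)"
  by (auto simp: chip_configs_def PiE_def)

lemma fire_eq: "fire G v \<sigma> = (\<lambda>w\<in>nonsinks G. \<sigma> w - L v w)"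
  by (auto simp: fire_def reduced_laplacian_def intro!: restrict_ext)

lemma add_configs_closed:
  "\<sigma> \<in> chip_configs G \<Longrightarrow> \<tau> \<in> chip_configs G \<Longrightarrow> add_configs G \<sigma> \<tau> \<in> chip_configs G"
  by (auto simp: chip_configs_iff add_configs_def)

lemma add_configs_commute: "add_configs G \<sigma> \<tau> = add_configs G \<tau> \<sigma>"
  by (simp add: add_configs_def add.commute)

lemma firing_step_closed:
  "firing_step G \<sigma> \<sigma>' \<Longrightarrow> \<sigma> \<in> chip_configs G \<Longrightarrow> \<sigma>' \<in> chip_configs G"
  by (auto simp: firing_step_def chip_configs_iff active_def fire_def)

lemma fires_closed: "fires \<sigma> \<sigma>' \<Longrightarrow> \<sigma> \<in> chip_configs G \<Longrightarrow> \<sigma>' \<in> chip_configs G"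
  by (induction rule: rtranclp_induct) (simp_all add: firing_step_closed)

lemma firing_step_add:
  assumes "firing_step G \<sigma> \<sigma>'" "\<beta> \<in> chip_configs G"
  shows "firing_step G (add_configs G \<sigma> \<beta>) (add_configs G \<sigma>' \<beta>)"
proof -
  obtain v where v: "active G \<sigma> v" "\<sigma>' = fire G v \<sigma>"
    using assms(1) by (auto simp: firing_step_def)
  have "active G (add_configs G \<sigma> \<beta>) v"
    using v(1) assms(2) by (force simp: active_def add_configs_def chip_configs_iff)
  moreover have "add_configs G \<sigma>' \<beta> = fire G v (add_configs G \<sigma> \<beta>)"
    unfolding v(2) by (auto simp: fire_eq add_configs_def intro!: restrict_ext)
  ultimately show ?thesis
    by (auto simp: firing_step_def)
qed

lemma fires_add:
  assumes "fires \<sigma> \<sigma>'" "\<beta> \<in> chip_configs G"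
  shows "fires (add_configs G \<sigma> \<beta>) (add_configs G \<sigma>' \<beta>)"
  using assms(1)
proof (induction rule: rtranclp_induct)
  case (step \<rho> \<rho>')
  from step.IH firing_step_add[OF step.hyps(2) assms(2)] show ?case
    by (meson rtranclp.rtrancl_into_rtrancl)
qed simp

section \<open>Existence and uniqueness of stabilizations\<close>

text \<open>Firing one vertex only adds chips to the others, so a second active vertex stays active.
  Both orders subtract the same two rows.\<close>

lemma firing_diamond:
  assumes "firing_step G \<sigma> \<sigma>\<^sub>1" "firing_step G \<sigma> \<sigma>\<^sub>2" "\<sigma>\<^sub>1 \<noteq> \<sigma>\<^sub>2"
  shows "\<exists>\<tau>. firing_step G \<sigma>\<^sub>1 \<tau> \<and> firing_step G \<sigma>\<^sub>2 \<tau>"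
proof -
  obtain v w where v: "active G \<sigma> v" "\<sigma>\<^sub>1 = fire G v \<sigma>" and w: "active G \<sigma> w" "\<sigma>\<^sub>2 = fire G w \<sigma>"
    using assms(1,2) by (auto simp: firing_step_def)
  have "v \<noteq> w"
    using assms(3) v w by auto
  then have "active G \<sigma>\<^sub>1 w" "active G \<sigma>\<^sub>2 v"
    using v w by (auto simp: active_def fire_def)
  moreover have "fire G w \<sigma>\<^sub>1 = fire G v \<sigma>\<^sub>2"
    unfolding v(2) w(2) by (auto simp: fire_eq intro!: restrict_ext)
  ultimately show ?thesis
    by (auto simp: firing_step_def)
qed

text \<open>By the diamond property a single firing either agrees with the next step of the path to
  \<tau> or can be passed along it. It is absorbed before the end, since nothing fires in
  \<tau>.\<close>

lemma fires_stable:
  assumes "fires \<sigma> \<tau>" "stable G \<tau>" "fires \<sigma> \<sigma>'"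
  shows "fires \<sigma>' \<tau>"
proof -
  have one: "fires \<sigma>' \<tau>" if "fires \<sigma> \<tau>" "firing_step G \<sigma> \<sigma>'" for \<sigma> \<sigma>'
    using that
  proof (induction arbitrary: \<sigma>' rule: converse_rtranclp_induct)
    case base
    then show ?case
      using assms(2) by (auto simp: firing_step_def stable_def)
  next
    case (step \<rho> \<rho>')
    show ?case
    proof (cases "\<sigma>' = \<rho>'")
      case True
      with step show ?thesis
        by simp
    next
      case False
      then obtain \<xi> where "firing_step G \<sigma>' \<xi>" "firing_step G \<rho>' \<xi>"
        using firing_diamond step.hyps(1) step.prems by metis
      then show ?thesis
        using step.IH by (meson converse_rtranclp_into_rtranclp)
    qed
  qed
  show ?thesis
    using assms(3) assms(1) by (induction rule: rtranclp_induct) (simp_all add: one)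
qed

lemma stabilization_eqI:
  assumes "fires \<sigma> \<tau>" "stable G \<tau>"
  shows "stab \<sigma> = \<tau>"
  unfolding stabilization_def
proof (rule the_equality)
  fix \<tau>'
  assume "fires \<sigma> \<tau>' \<and> stable G \<tau>'"
  then have "fires \<tau> \<tau>'"
    using assms fires_stable by blast
  then show "\<tau>' = \<tau>"
    using assms(2) by (cases rule: converse_rtranclpE) (auto simp: firing_step_def stable_def)
qed (use assms in auto)

text \<open>The weighted number of chips is a potential: firing \<open>v\<close> subtracts row
  \<open>v\<close>, whose weighted sum is at least 1.\<close>

lemma stable_reachable:
  assumes "\<sigma> \<in> chip_configs G"
  shows "\<exists>\<tau>. fires \<sigma> \<tau> \<and> stable G \<tau>"
proof -
  obtain h :: "'a \<Rightarrow> int" where h0: "\<And>v. 0 \<le> h v"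
    and h1: "\<And>v. v \<in> nonsinks G \<Longrightarrow> 1 \<le> (\<Sum>w\<in>nonsinks G. L v w * h w)"
    using weight_exists by blast
  define \<Phi> where "\<Phi> \<sigma> = (\<Sum>w\<in>nonsinks G. \<sigma> w * h w)" for \<sigma>
  from assms show ?thesis
  proof (induction "nat (\<Phi> \<sigma>)" arbitrary: \<sigma> rule: less_induct)
    case less
    show ?case
    proof (cases "stable G \<sigma>")
      case False
      then obtain v where v: "active G \<sigma> v"
        by (auto simp: stable_def)
      then have step: "firing_step G \<sigma> (fire G v \<sigma>)"
        by (auto simp: firing_step_def)
      then have chip: "fire G v \<sigma> \<in> chip_configs G"
        using less.prems by (rule firing_step_closed)
      have "\<Phi> (fire G v \<sigma>) = \<Phi> \<sigma> - (\<Sum>w\<in>nonsinks G. L v w * h w)"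
        unfolding \<Phi>_def fire_eq by (simp add: left_diff_distrib sum_subtractf)
      then have "\<Phi> (fire G v \<sigma>) < \<Phi> \<sigma>"
        using h1[of v] v by (simp add: active_def)
      \<comment> \<open>Non-negativity ensures that the decrease survives the truncation by
        \<open>nat\<close> in the induction measure.\<close>
      moreover have "0 \<le> \<Phi> (fire G v \<sigma>)"
        unfolding \<Phi>_def using chip h0 by (intro sum_nonneg) (simp add: chip_configs_iff)
      ultimately have "nat (\<Phi> (fire G v \<sigma>)) < nat (\<Phi> \<sigma>)"
        by simp
      then obtain \<tau> where "fires (fire G v \<sigma>) \<tau>" "stable G \<tau>"
        using less.hyps[OF _ chip] by blast
      with step show ?thesis
        by (meson converse_rtranclp_into_rtranclp)
    qed auto
  qed
qed

lemma stabilization: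
  assumes "\<sigma> \<in> chip_configs G"
  shows fires_stab: "fires \<sigma> (stab \<sigma>)"
    and stable_stab: "stable G (stab \<sigma>)"
    and stab_closed: "stab \<sigma> \<in> chip_configs G"
proof -
  obtain \<tau> where \<tau>: "fires \<sigma> \<tau>" "stable G \<tau>"
    using stable_reachable assms by blast
  then have "stab \<sigma> = \<tau>"
    by (rule stabilization_eqI)
  with \<tau> assms show "fires \<sigma> (stab \<sigma>)" "stable G (stab \<sigma>)" "stab \<sigma> \<in> chip_configs G"
    by (simp_all add: fires_closed)
qed

lemma stab_fires:
  assumes "fires \<sigma> \<tau>" "\<sigma> \<in> chip_configs G"
  shows "stab \<tau> = stab \<sigma>"
proof (rule stabilization_eqI)
  show "fires \<tau> (stab \<sigma>)"
    using fires_stab[OF assms(2)] stable_stab[OF assms(2)] assms(1) by (rule fires_stable)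
qed (rule stable_stab[OF assms(2)])

text \<open>The firings that stabilize \<sigma> remain legal in the presence of \<beta>, so
  stabilizing early does not change the final outcome.\<close>

lemma stab_add_stab:
  assumes "\<sigma> \<in> chip_configs G" "\<beta> \<in> chip_configs G"
  shows "stab (add_configs G (stab \<sigma>) \<beta>) = stab (add_configs G \<sigma> \<beta>)"
proof -
  have "fires (add_configs G \<sigma> \<beta>) (add_configs G (stab \<sigma>) \<beta>)"
    using fires_stab[OF assms(1)] assms(2) by (rule fires_add)
  then show ?thesis
    using add_configs_closed[OF assms] by (rule stab_fires)
qed

section \<open>Recurrent configurations as stabilizations of large ones\<close>

lemma stable_iff: "stable G \<sigma> \<longleftrightarrow> (\<forall>v\<in>nonsinks G. \<sigma> v < int (out_degree G v))"
  by (auto simp: stable_def active_def not_le)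

abbreviation degs :: "'a \<Rightarrow> int" where
  "degs \<equiv> \<lambda>v\<in>nonsinks G. int (out_degree G v)"

text \<open>Extra chips never invalidate a firing, so all additions can be moved ahead of the
  firings and merged into a single \<beta>.\<close>

lemma accessible_fires:
  assumes "\<tau> \<in> chip_configs G" and reach: "(\<lambda>\<rho> \<rho>'. adding_step G \<rho> \<rho>' \<or> firing_step G \<rho> \<rho>')\<^sup>*\<^sup>* \<tau> \<sigma>"
  shows "\<exists>\<beta>\<in>chip_configs G. fires (add_configs G \<tau> \<beta>) \<sigma>"
  using reach
proof (induction rule: rtranclp_induct)
  case base
  have "add_configs G \<tau> (\<lambda>v\<in>nonsinks G. 0) = \<tau>"
    using assms(1) by (auto simp: add_configs_def chip_configs_iff fun_eq_iff extensional_def)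
  moreover have "(\<lambda>v\<in>nonsinks G. 0) \<in> chip_configs G"
    by (simp add: chip_configs_iff)
  ultimately show ?case
    by (metis rtranclp.rtrancl_refl)
next
  case (step \<rho> \<rho>')
  then obtain \<beta> where \<beta>: "\<beta> \<in> chip_configs G" "fires (add_configs G \<tau> \<beta>) \<rho>"
    by blast
  from step.hyps(2) show ?case
  proof
    assume "adding_step G \<rho> \<rho>'"
    then obtain \<gamma> where \<gamma>: "\<gamma> \<in> chip_configs G" "\<rho>' = add_configs G \<rho> \<gamma>"
      by (auto simp: adding_step_def)
    have "add_configs G (add_configs G \<tau> \<beta>) \<gamma> = add_configs G \<tau> (add_configs G \<beta> \<gamma>)"
      by (auto simp: add_configs_def intro!: restrict_ext)
    then have "fires (add_configs G \<tau> (add_configs G \<beta> \<gamma>)) \<rho>'"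
      using fires_add[OF \<beta>(2) \<gamma>(1)] \<gamma>(2) by simp
    with add_configs_closed[OF \<beta>(1) \<gamma>(1)] show ?thesis
      by blast
  next
    assume "firing_step G \<rho> \<rho>'"
    with \<beta>(2) have "fires (add_configs G \<tau> \<beta>) \<rho>'"
      by (meson rtranclp.rtrancl_into_rtrancl)
    with \<beta>(1) show ?thesis
      by blast
  qed
qed

text \<open>Used with \<tau> = \<open>degs\<close> to write a recurrent configuration as the
  stabilization of one that dominates \<open>degs\<close>.\<close>

lemma recurrent_imp_stab:
  assumes "\<sigma> \<in> recurrent_configs G" "\<tau> \<in> chip_configs G"
  shows "\<exists>\<beta>\<in>chip_configs G. stab (add_configs G \<tau> \<beta>) = \<sigma>"
proof -
  \<comment> \<open>Accessibility only speaks of starting points other than \<sigma>; from \<sigma>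
    itself the empty sequence serves.\<close>
  have "(\<lambda>\<rho> \<rho>'. adding_step G \<rho> \<rho>' \<or> firing_step G \<rho> \<rho>')\<^sup>*\<^sup>* \<tau> \<sigma>"
    using assms by (cases "\<tau> = \<sigma>") (auto simp: recurrent_configs_def accessible_def)
  then obtain \<beta> where "\<beta> \<in> chip_configs G" "fires (add_configs G \<tau> \<beta>) \<sigma>"
    using accessible_fires[OF assms(2)] by blast
  moreover have "stable G \<sigma>"
    using assms(1) by (simp add: recurrent_configs_def)
  ultimately show ?thesis
    using stabilization_eqI by blast
qed

text \<open>A stable configuration has at most \<open>degs v - 1\<close> chips at \<open>v\<close>.
  Hence any \<tau> can be stabilized, filled up to \<rho> and stabilized again.\<close>

lemma stab_recurrent:
  assumes \<rho>: "\<rho> \<in> chip_configs G" and large: "\<And>v. v \<in> nonsinks G \<Longrightarrow> degs v - 1 \<le> \<rho> v"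
  shows "stab \<rho> \<in> recurrent_configs G"
proof -
  have "(\<lambda>\<rho> \<rho>'. adding_step G \<rho> \<rho>' \<or> firing_step G \<rho> \<rho>')\<^sup>*\<^sup>* \<tau> (stab \<rho>)" (is "?R\<^sup>*\<^sup>* _ _")
    if \<tau>: "\<tau> \<in> chip_configs G" for \<tau>
  proof -
    have mono: "?R\<^sup>*\<^sup>* \<alpha> \<beta>" if "fires \<alpha> \<beta>" for \<alpha> \<beta>
      using that by (rule mono_rtranclp[rule_format, rotated]) auto
    define \<beta> where "\<beta> = (\<lambda>v\<in>nonsinks G. \<rho> v - stab \<tau> v)"
    have "\<beta> \<in> chip_configs G"
      using stable_stab[OF \<tau>] large by (force simp: \<beta>_def chip_configs_iff stable_iff)
    moreover have "\<rho> = add_configs G (stab \<tau>) \<beta>"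
      using \<rho> by (auto simp: \<beta>_def add_configs_def chip_configs_iff fun_eq_iff extensional_def)
    ultimately have "?R (stab \<tau>) \<rho>"
      by (auto simp: adding_step_def)
    then have "?R\<^sup>*\<^sup>* (stab \<tau>) \<rho>"
      by (intro r_into_rtranclp)
    with mono[OF fires_stab[OF \<tau>]] have "?R\<^sup>*\<^sup>* \<tau> \<rho>"
      by (rule rtranclp_trans)
    then show ?thesis
      using mono[OF fires_stab[OF \<rho>]] by (rule rtranclp_trans)
  qed
  then show ?thesis
    using stabilization[OF \<rho>] by (auto simp: recurrent_configs_def accessible_def)
qed

lemma recurrent_chip: "\<sigma> \<in> recurrent_configs G \<Longrightarrow> \<sigma> \<in> chip_configs G"
  by (simp add: recurrent_configs_def)

text \<open>Replacing \<sigma> by an unstabilized preimage above \<open>degs\<close> leaves the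
  product unchanged, and adding \<tau> keeps it above \<open>degs\<close>.\<close>

lemma recurrent_mult_closed:
  assumes \<sigma>: "\<sigma> \<in> recurrent_configs G" and \<tau>: "\<tau> \<in> recurrent_configs G"
  shows "recurrent_mult G \<sigma> \<tau> \<in> recurrent_configs G"
proof -
  have d: "degs \<in> chip_configs G"
    by (auto simp: chip_configs_iff)
  obtain \<beta> where \<beta>: "\<beta> \<in> chip_configs G" "stab (add_configs G degs \<beta>) = \<sigma>"
    using recurrent_imp_stab[OF \<sigma> d] by blast
  let ?\<rho> = "add_configs G (add_configs G degs \<beta>) \<tau>"
  have "recurrent_mult G \<sigma> \<tau> = stab ?\<rho>"
    unfolding recurrent_mult_def using \<beta> d \<tau>
    by (metis stab_add_stab add_configs_closed recurrent_chip)
  moreover have "stab ?\<rho> \<in> recurrent_configs G"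
  proof (intro stab_recurrent add_configs_closed d \<beta>(1) recurrent_chip[OF \<tau>])
    fix v
    assume "v \<in> nonsinks G"
    with \<beta>(1) recurrent_chip[OF \<tau>] have "0 \<le> \<beta> v" "0 \<le> \<tau> v" "v \<in> nonsinks G"
      by (auto simp: chip_configs_iff)
    then show "degs v - 1 \<le> ?\<rho> v"
      by (simp add: add_configs_def)
  qed
  ultimately show ?thesis
    by simp
qed

section \<open>Equivalence modulo the row span\<close>

definition lap_equiv :: "('a \<Rightarrow> int) \<Rightarrow> ('a \<Rightarrow> int) \<Rightarrow> bool" where
  "lap_equiv \<sigma> \<tau> \<longleftrightarrow> (\<exists>c. \<sigma> = (\<lambda>w\<in>nonsinks G. row c w + \<tau> w))"

text \<open>Each firing subtracts a row, so the coefficients are negated firing counts.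
  Stabilization therefore stays within a class.\<close>

lemma fires_lap_equiv:
  assumes "fires \<sigma> \<tau>" "\<sigma> \<in> chip_configs G"
  shows "lap_equiv \<tau> \<sigma>"
  using assms
proof (induction rule: rtranclp_induct)
  case base
  then show ?case
    unfolding lap_equiv_def
    by (intro exI[of _ "\<lambda>_. 0"]) (auto simp: chip_configs_iff fun_eq_iff extensional_def)
next
  case (step \<rho> \<rho>')
  then obtain c where c: "\<rho> = (\<lambda>w\<in>nonsinks G. row c w + \<sigma> w)"
    by (auto simp: lap_equiv_def)
  obtain v where v: "v \<in> nonsinks G" "\<rho>' = fire G v \<rho>"
    using step.hyps(2) by (auto simp: firing_step_def active_def)
  have "row (\<lambda>u. c u - (if u = v then 1 else 0)) w = row c w - L v w" for w
    using v(1) by (simp add: left_diff_distrib sum_subtractf if_distrib[of "\<lambda>x. x * _"] cong: if_cong)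
  then have "\<rho>' = (\<lambda>w\<in>nonsinks G. row (\<lambda>u. c u - (if u = v then 1 else 0)) w + \<sigma> w)"
    unfolding v(2) fire_eq c by (auto intro!: restrict_ext)
  then show ?case
    unfolding lap_equiv_def by (intro exI[of _ "\<lambda>u. c u - (if u = v then 1 else 0)"])
qed

text \<open>A vertex holding enough chips for all its planned firings stays ready, since the others
  only send it chips. Any order is thus legal, and the induction is on the total number of
  firings.\<close>

lemma fires_rows:
  fixes c :: "'a \<Rightarrow> nat"
  assumes "\<sigma> \<in> chip_configs G"
    and "\<And>v. v \<in> nonsinks G \<Longrightarrow> int (c v) * int (out_degree G v) \<le> \<sigma> v"
  shows "fires \<sigma> (\<lambda>w\<in>nonsinks G. \<sigma> w - row (\<lambda>v. int (c v)) w)"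
  using assms
proof (induction "\<Sum>v\<in>nonsinks G. c v" arbitrary: c \<sigma>)
  case 0
  then have "\<sigma> = (\<lambda>w\<in>nonsinks G. \<sigma> w - row (\<lambda>v. int (c v)) w)"
    by (auto simp: chip_configs_iff fun_eq_iff extensional_def)
  then show ?case
    by (metis rtranclp.rtrancl_refl)
next
  case (Suc n)
  then obtain v where v: "v \<in> nonsinks G" "0 < c v"
    by (metis finite_nonsinks nat.simps(3) neq0_conv sum.neutral)
  define c' where "c' = c(v := c v - 1)"
  have cc': "c u = c' u + (if u = v then 1 else 0)" for u
    using v by (simp add: c'_def)
  then have int_c: "int (c u) = int (c' u) + (if u = v then 1 else 0)" for u
    by simp
  have n: "n = (\<Sum>v\<in>nonsinks G. c' v)"
    using Suc.hyps(2) v by (simp add: cc' sum.distrib)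
  have "int (out_degree G v) \<le> int (c v) * int (out_degree G v)"
    using v by (simp add: mult_le_cancel_right1)
  then have "active G \<sigma> v"
    using v Suc.prems(2)[of v] by (simp add: active_def)
  then have step: "firing_step G \<sigma> (fire G v \<sigma>)"
    by (auto simp: firing_step_def)
  \<comment> \<open>Firing \<open>v\<close> costs it at most its out-degree, which matches lowering
    its count by one; all other vertices can only gain.\<close>
  have "int (c' w) * int (out_degree G w) \<le> fire G v \<sigma> w" if "w \<in> nonsinks G" for w
    using Suc.prems(2)[OF that] that v
    by (auto simp: cc' fire_def algebra_simps)
  then have "fires (fire G v \<sigma>) (\<lambda>w\<in>nonsinks G. fire G v \<sigma> w - row (\<lambda>v. int (c' v)) w)"
    using Suc.hyps(1)[OF n firing_step_closed[OF step Suc.prems(1)]] by blast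
  also have "(\<lambda>w\<in>nonsinks G. fire G v \<sigma> w - row (\<lambda>v. int (c' v)) w)
      = (\<lambda>w\<in>nonsinks G. \<sigma> w - row (\<lambda>v. int (c v)) w)"
    using v by (intro restrict_ext)
      (simp add: int_c fire_eq distrib_right sum.distrib if_distrib[of "\<lambda>x. x * _"] cong: if_cong)
  finally show ?case
    using step by (meson converse_rtranclp_into_rtranclp)
qed

section \<open>A strictly positive vector in the row span\<close>

definition eps :: "'a \<Rightarrow> int" where
  "eps = (\<lambda>v\<in>nonsinks G. degs v - stab degs v)"

lemma degs_chip: "degs \<in> chip_configs G"
  by (auto simp: chip_configs_iff)

text \<open>The stabilization of \<open>degs\<close> has fewer than d_v chips at each
  \<open>v\<close>, while \<open>degs\<close> has exactly d_v.\<close>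

lemma eps_pos: "v \<in> nonsinks G \<Longrightarrow> 1 \<le> eps v"
  using stable_stab[OF degs_chip] by (force simp: eps_def stable_iff)

lemma eps_chip: "eps \<in> chip_configs G"
  using eps_pos by (force simp: chip_configs_iff eps_def)

lemma eps_row: "\<exists>c. \<forall>w\<in>nonsinks G. eps w = row c w"
proof -
  obtain c where c: "stab degs = (\<lambda>w\<in>nonsinks G. row c w + degs w)"
    using fires_lap_equiv[OF fires_stab[OF degs_chip] degs_chip] by (auto simp: lap_equiv_def)
  have "eps w = row (\<lambda>v. - c v) w" if "w \<in> nonsinks G" for w
    using that by (simp add: eps_def c sum_negf)
  then show ?thesis
    by (intro exI[of _ "\<lambda>v. - c v"] ballI)
qed

text \<open>With \<sigma> the stabilization of \<open>degs\<close> + \<beta>, it is also that of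
  \<open>stab degs\<close> + \<beta>. Adding \<open>eps\<close> to the latter gives back
  \<open>degs\<close> + \<beta>.\<close>

lemma stab_add_eps:
  assumes "\<sigma> \<in> recurrent_configs G"
  shows "stab (add_configs G \<sigma> eps) = \<sigma>"
proof -
  obtain \<beta> where \<beta>: "\<beta> \<in> chip_configs G" "stab (add_configs G degs \<beta>) = \<sigma>"
    using recurrent_imp_stab[OF assms degs_chip] by blast
  let ?\<tau> = "add_configs G (stab degs) \<beta>"
  have \<tau>: "?\<tau> \<in> chip_configs G" "stab ?\<tau> = \<sigma>"
    using \<beta> by (simp_all add: add_configs_closed stab_closed degs_chip stab_add_stab)
  have "stab (add_configs G \<sigma> eps) = stab (add_configs G ?\<tau> eps)"
    using stab_add_stab[OF \<tau>(1) eps_chip] \<tau>(2) by simp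
  also have "add_configs G ?\<tau> eps = add_configs G degs \<beta>"
    by (auto simp: add_configs_def eps_def intro!: restrict_ext)
  finally show ?thesis
    using \<beta>(2) by simp
qed

lemma stab_add_mult_eps:
  fixes k :: nat
  assumes "\<sigma> \<in> recurrent_configs G"
  shows "stab (\<lambda>v\<in>nonsinks G. \<sigma> v + int k * eps v) = \<sigma>"
proof (induction k)
  case 0
  have "(\<lambda>v\<in>nonsinks G. \<sigma> v + int 0 * eps v) = \<sigma>"
    using recurrent_chip[OF assms] by (auto simp: chip_configs_iff fun_eq_iff extensional_def)
  moreover have "stab \<sigma> = \<sigma>"
    using assms by (intro stabilization_eqI) (auto simp: recurrent_configs_def)
  ultimately show ?case
    by simp
next
  case (Suc k)
  let ?\<rho> = "\<lambda>v\<in>nonsinks G. \<sigma> v + int k * eps v"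
  have "?\<rho> \<in> chip_configs G"
    using recurrent_chip[OF assms] eps_chip by (auto simp: chip_configs_iff)
  moreover have "(\<lambda>v\<in>nonsinks G. \<sigma> v + int (Suc k) * eps v) = add_configs G ?\<rho> eps"
    by (auto simp: add_configs_def algebra_simps intro!: restrict_ext)
  ultimately show ?case
    using stab_add_stab[of ?\<rho> eps] eps_chip Suc.IH stab_add_eps[OF assms] by metis
qed

section \<open>Exactly one recurrent configuration in each class\<close>

lemma recurrent_unique:
  assumes \<sigma>: "\<sigma> \<in> recurrent_configs G" and \<tau>: "\<tau> \<in> recurrent_configs G" and eq: "lap_equiv \<sigma> \<tau>"
  shows "\<sigma> = \<tau>"
proof -
  obtain c where c: "\<sigma> = (\<lambda>w\<in>nonsinks G. row c w + \<tau> w)"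
    using eq by (auto simp: lap_equiv_def)
  \<comment> \<open>Since \<open>eps\<close> is at least 1 everywhere, adding \<open>k\<close>
    copies of it gives each \<open>v\<close> enough chips to fire \<bar>\<open>c v\<close>\<bar>
    times.\<close>
  define k where "k = (\<Sum>v\<in>nonsinks G. nat \<bar>c v\<bar> * out_degree G v)"
  let ?add = "\<lambda>\<sigma>. \<lambda>v\<in>nonsinks G. \<sigma> v + int k * eps v"
  \<comment> \<open>Stated for general \<rho> and \<open>p\<close> so that it serves both \<sigma>
    with the positive part of \<open>c\<close> and \<tau> with its negative part.\<close>
  have fires: "fires (?add \<rho>) (\<lambda>w\<in>nonsinks G. ?add \<rho> w - row (\<lambda>v. int (p v)) w)"
    and chip: "?add \<rho> \<in> chip_configs G"
    if \<rho>: "\<rho> \<in> recurrent_configs G" and p: "\<And>v. p v \<le> nat \<bar>c v\<bar>" for \<rho> p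
  proof -
    show chip: "?add \<rho> \<in> chip_configs G"
      using recurrent_chip[OF \<rho>] eps_chip by (auto simp: chip_configs_iff)
    have "int (p v) * int (out_degree G v) \<le> ?add \<rho> v" if v: "v \<in> nonsinks G" for v
    proof -
      have "p v * out_degree G v \<le> nat \<bar>c v\<bar> * out_degree G v"
        by (rule mult_right_mono[OF p]) simp
      also have "\<dots> \<le> k"
        unfolding k_def using v by (intro member_le_sum) auto
      finally have "int (p v) * int (out_degree G v) \<le> int k"
        by (metis of_nat_le_iff of_nat_mult)
      also have "\<dots> \<le> int k * eps v"
        using eps_pos[OF v] by (simp add: mult_le_cancel_left1)
      finally show ?thesis
        using v recurrent_chip[OF \<rho>] by (auto simp: chip_configs_iff)
    qed
    then show "fires (?add \<rho>) (\<lambda>w\<in>nonsinks G. ?add \<rho> w - row (\<lambda>v. int (p v)) w)"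
      by (rule fires_rows[OF chip])
  qed
  let ?p = "\<lambda>v. nat (c v)" and ?q = "\<lambda>v. nat (- c v)"
  have "row c w = row (\<lambda>v. int (?p v)) w - row (\<lambda>v. int (?q v)) w" for w
    by (simp flip: sum_subtractf left_diff_distrib) (auto intro!: sum.cong)
  \<comment> \<open>Moving the negative part of \<open>c\<close> to the other side turns the
    equivalence into a common target of two legal firing sequences.\<close>
  then have meet: "(\<lambda>w\<in>nonsinks G. ?add \<sigma> w - row (\<lambda>v. int (?p v)) w)
      = (\<lambda>w\<in>nonsinks G. ?add \<tau> w - row (\<lambda>v. int (?q v)) w)"
    unfolding c by (intro restrict_ext) simp
  have "\<sigma> = stab (?add \<sigma>)"
    using stab_add_mult_eps[OF \<sigma>] by simp
  also have "\<dots> = stab (\<lambda>w\<in>nonsinks G. ?add \<sigma> w - row (\<lambda>v. int (?p v)) w)"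
    using stab_fires[OF fires[OF \<sigma>] chip[OF \<sigma>], of ?p ?p] by simp
  also have "\<dots> = stab (?add \<tau>)"
    unfolding meet using stab_fires[OF fires[OF \<tau>] chip[OF \<tau>], of ?q ?q] by simp
  also have "\<dots> = \<tau>"
    using stab_add_mult_eps[OF \<tau>] by simp
  finally show ?thesis .
qed

lemma recurrent_exists: "\<exists>\<sigma>\<in>recurrent_configs G. lap_equiv \<sigma> \<alpha>"
proof -
  \<comment> \<open>As \<open>eps v\<close> is at least 1, this multiple compensates a negative
    \<open>\<alpha> v\<close> and still leaves d_v chips at every \<open>v\<close>.\<close>
  define k where "k = (\<Sum>v\<in>nonsinks G. \<bar>\<alpha> v\<bar> + int (out_degree G v))"
  define \<rho> where "\<rho> = (\<lambda>v\<in>nonsinks G. \<alpha> v + k * eps v)"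
  have big: "int (out_degree G v) \<le> \<rho> v" if v: "v \<in> nonsinks G" for v
  proof -
    have "\<bar>\<alpha> v\<bar> + int (out_degree G v) \<le> k"
      unfolding k_def using v by (intro member_le_sum[where f = "\<lambda>v. \<bar>\<alpha> v\<bar> + int (out_degree G v)"]) auto
    moreover from this have "k \<le> k * eps v"
      using mult_left_mono[OF eps_pos[OF v], of k] by simp
    ultimately show ?thesis
      using v by (simp add: \<rho>_def)
  qed
  have \<rho>: "\<rho> \<in> chip_configs G"
    using big by (force simp: chip_configs_iff \<rho>_def)
  obtain e where e: "\<And>w. w \<in> nonsinks G \<Longrightarrow> eps w = row e w"
    using eps_row by blast
  obtain c where c: "stab \<rho> = (\<lambda>w\<in>nonsinks G. row c w + \<rho> w)"
    using fires_lap_equiv[OF fires_stab[OF \<rho>] \<rho>] by (auto simp: lap_equiv_def)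
  \<comment> \<open>The total coefficients combine those of the stabilizing firings with
    \<open>k\<close> times those expressing \<open>eps\<close> by rows.\<close>
  have "stab \<rho> = (\<lambda>w\<in>nonsinks G. row (\<lambda>v. c v + k * e v) w + \<alpha> w)"
    unfolding c by (intro restrict_ext)
      (simp add: \<rho>_def e distrib_right sum.distrib sum_distrib_left mult.assoc)
  moreover have "stab \<rho> \<in> recurrent_configs G"
    using big by (intro stab_recurrent \<rho>) force
  ultimately show ?thesis
    unfolding lap_equiv_def by (intro bexI exI)
qed

section \<open>The isomorphism with the sandpile group\<close>

sublocale lattice: normal "laplacian_row_span G" "int_vectors G"
  by (rule laplacian_row_span_normal)

lemma carrier_int_vectors: "carrier (int_vectors G) = extensional (nonsinks G)"
  by (auto simp: int_vectors_def PiE_def integer_group_def)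

lemma comm_group_int_vectors: "comm_group (int_vectors G)"
  by (intro lattice.group_comm_groupI)
     (auto simp: int_vectors_def integer_group_def intro!: restrict_ext)

text \<open>\<open>lap_equiv\<close> unfolds to membership of \<sigma> in the coset of \<tau>, and a
  coset is determined by any of its elements.\<close>

lemma coset_eq_iff:
  assumes "\<sigma> \<in> extensional (nonsinks G)" "\<tau> \<in> extensional (nonsinks G)"
  shows "laplacian_row_span G #>\<^bsub>int_vectors G\<^esub> \<sigma> = laplacian_row_span G #>\<^bsub>int_vectors G\<^esub> \<tau>
    \<longleftrightarrow> lap_equiv \<sigma> \<tau>"
proof -
  have "lap_equiv \<sigma> \<tau> \<longleftrightarrow> \<sigma> \<in> laplacian_row_span G #>\<^bsub>int_vectors G\<^esub> \<tau>"
    by (auto simp: lap_equiv_def r_coset_def laplacian_row_span_def int_vectors_def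
        integer_group_def cong: restrict_cong)
  also have "\<dots> \<longleftrightarrow> laplacian_row_span G #>\<^bsub>int_vectors G\<^esub> \<sigma> = laplacian_row_span G #>\<^bsub>int_vectors G\<^esub> \<tau>"
    using assms lattice.repr_independence[of \<sigma> "laplacian_row_span G" \<tau>] lattice.rcos_self[of \<sigma>]
      lattice.subgroup_axioms carrier_int_vectors by auto
  finally show ?thesis ..
qed

lemma recurrent_extensional: "\<sigma> \<in> recurrent_configs G \<Longrightarrow> \<sigma> \<in> extensional (nonsinks G)"
  by (simp add: recurrent_configs_def chip_configs_iff)

abbreviation incl :: "('a \<Rightarrow> int) \<Rightarrow> ('a \<Rightarrow> int) set" where
  "incl \<sigma> \<equiv> laplacian_row_span G #>\<^bsub>int_vectors G\<^esub> \<sigma>"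

text \<open>Injectivity is the uniqueness and surjectivity the existence of a recurrent
  representative.\<close>

lemma incl_bij: "bij_betw incl (recurrent_configs G) (carrier (sandpile_group G))"
proof -
  have "inj_on incl (recurrent_configs G)"
    by (rule inj_onI) (simp add: coset_eq_iff recurrent_extensional recurrent_unique)
  moreover have "incl ` recurrent_configs G = carrier (sandpile_group G)"
  proof -
    have "X \<in> incl ` recurrent_configs G" if X: "X \<in> carrier (sandpile_group G)" for X
    proof -
      obtain \<alpha> where \<alpha>: "\<alpha> \<in> extensional (nonsinks G)" "X = incl \<alpha>"
        using X by (auto simp: sandpile_group_def FactGroup_def RCOSETS_def carrier_int_vectors)
      with recurrent_exists[of \<alpha>] show ?thesis
        by (metis coset_eq_iff recurrent_extensional imageI)
    qed
    moreover have "incl \<sigma> \<in> carrier (sandpile_group G)" if "\<sigma> \<in> recurrent_configs G" for \<sigma>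
      using recurrent_extensional[OF that]
      by (auto simp: sandpile_group_def FactGroup_def RCOSETS_def carrier_int_vectors)
    ultimately show ?thesis
      by blast
  qed
  ultimately show ?thesis
    by (simp add: bij_betw_def)
qed

text \<open>Stabilizing changes a vector only by the row span, so the product has the class of the
  plain sum.\<close>

lemma incl_mult:
  assumes "\<sigma> \<in> recurrent_configs G" "\<tau> \<in> recurrent_configs G"
  shows "incl (recurrent_mult G \<sigma> \<tau>) = incl \<sigma> \<otimes>\<^bsub>sandpile_group G\<^esub> incl \<tau>"
proof -
  let ?\<rho> = "add_configs G \<sigma> \<tau>"
  have \<rho>: "?\<rho> \<in> chip_configs G"
    using assms by (intro add_configs_closed recurrent_chip)
  have "incl (stab ?\<rho>) = incl ?\<rho>"
    using fires_lap_equiv[OF fires_stab[OF \<rho>] \<rho>] \<rho> stab_closed[OF \<rho>]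
    by (simp add: coset_eq_iff chip_configs_iff)
  moreover have "?\<rho> = \<sigma> \<otimes>\<^bsub>int_vectors G\<^esub> \<tau>"
    by (simp add: add_configs_def int_vectors_def integer_group_def)
  ultimately show ?thesis
    using assms
    by (simp add: recurrent_mult_def sandpile_group_def lattice.rcos_sum carrier_int_vectors
        recurrent_extensional)
qed

lemma comm_group_sandpile: "comm_group (sandpile_group G)"
  unfolding sandpile_group_def
  using comm_group.abelian_FactGroup[OF comm_group_int_vectors] lattice.subgroup_axioms by blast

lemma incl_closed: "\<sigma> \<in> recurrent_configs G \<Longrightarrow> incl \<sigma> \<in> carrier (sandpile_group G)"
  using incl_bij by (rule bij_betw_apply)

lemma incl_inj:
  "\<sigma> \<in> recurrent_configs G \<Longrightarrow> \<tau> \<in> recurrent_configs G \<Longrightarrow> incl \<sigma> = incl \<tau> \<Longrightarrow> \<sigma> = \<tau>"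
  using incl_bij by (simp add: bij_betw_def inj_on_def)

lemma incl_surj:
  assumes "X \<in> carrier (sandpile_group G)"
  obtains \<sigma> where "\<sigma> \<in> recurrent_configs G" "incl \<sigma> = X"
  using bij_betw_imp_surj_on[OF incl_bij] assms by (metis imageE)

text \<open>The unit is given by a description and must be identified: the recurrent preimage of the
  trivial class is neutral by injectivity of \<open>incl\<close>, and a two-sided neutral element is
  unique.\<close>

lemma recurrent_one:
  shows "\<one>\<^bsub>recurrent_group G\<^esub> \<in> recurrent_configs G"
    and "incl \<one>\<^bsub>recurrent_group G\<^esub> = \<one>\<^bsub>sandpile_group G\<^esub>"
proof -
  interpret S: comm_group "sandpile_group G"
    by (rule comm_group_sandpile)
  obtain \<epsilon> where \<epsilon>: "\<epsilon> \<in> recurrent_configs G" "incl \<epsilon> = \<one>\<^bsub>sandpile_group G\<^esub>"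
    using incl_surj[OF S.one_closed] by blast
  have neutral: "recurrent_mult G \<epsilon> \<sigma> = \<sigma> \<and> recurrent_mult G \<sigma> \<epsilon> = \<sigma>"
    if \<sigma>: "\<sigma> \<in> recurrent_configs G" for \<sigma>
    using \<sigma> \<epsilon> incl_closed[OF \<sigma>]
    by (intro conjI incl_inj) (simp_all add: incl_mult recurrent_mult_closed)
  have "\<one>\<^bsub>recurrent_group G\<^esub> = (THE \<epsilon>. \<epsilon> \<in> recurrent_configs G \<and>
      (\<forall>\<sigma>\<in>recurrent_configs G. recurrent_mult G \<epsilon> \<sigma> = \<sigma> \<and> recurrent_mult G \<sigma> \<epsilon> = \<sigma>))"
    by (simp add: recurrent_group_def)
  also have "\<dots> = \<epsilon>"
    using \<epsilon>(1) neutral by (intro the_equality) metis+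
  finally show "\<one>\<^bsub>recurrent_group G\<^esub> \<in> recurrent_configs G"
    "incl \<one>\<^bsub>recurrent_group G\<^esub> = \<one>\<^bsub>sandpile_group G\<^esub>"
    using \<epsilon> by simp_all
qed

lemma incl_iso: "incl \<in> iso (recurrent_group G) (sandpile_group G)"
proof (rule isoI)
  show "bij_betw incl (carrier (recurrent_group G)) (carrier (sandpile_group G))"
    using incl_bij by (simp add: recurrent_group_def)
  then show "incl \<in> hom (recurrent_group G) (sandpile_group G)"
    by (intro homI) (auto simp: recurrent_group_def incl_mult dest: bij_betwE)
qed

text \<open>Associativity, neutrality and inverses are pulled back along the bijection
  \<open>incl\<close>; commutativity comes directly from adding chips.\<close>

lemma comm_group_recurrent: "comm_group (recurrent_group G)"
proof -
  interpret S: comm_group "sandpile_group G"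
    by (rule comm_group_sandpile)
  have sel: "carrier (recurrent_group G) = recurrent_configs G"
      "mult (recurrent_group G) = recurrent_mult G"
    by (simp_all add: recurrent_group_def)
  show ?thesis
  proof (rule comm_groupI; unfold sel)
    fix \<sigma> \<tau> \<rho>
    assume \<sigma>: "\<sigma> \<in> recurrent_configs G" and \<tau>: "\<tau> \<in> recurrent_configs G"
      and \<rho>: "\<rho> \<in> recurrent_configs G"
    show "recurrent_mult G (recurrent_mult G \<sigma> \<tau>) \<rho> = recurrent_mult G \<sigma> (recurrent_mult G \<tau> \<rho>)"
      using \<sigma> \<tau> \<rho>
      by (intro incl_inj) (simp_all add: incl_mult recurrent_mult_closed incl_closed S.m_assoc)
  next
    fix \<sigma>
    assume \<sigma>: "\<sigma> \<in> recurrent_configs G"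
    show "recurrent_mult G \<one>\<^bsub>recurrent_group G\<^esub> \<sigma> = \<sigma>"
      using \<sigma>
      by (intro incl_inj)
        (simp_all add: incl_mult recurrent_mult_closed incl_closed recurrent_one)
    obtain \<tau> where \<tau>: "\<tau> \<in> recurrent_configs G" "incl \<tau> = inv\<^bsub>sandpile_group G\<^esub> incl \<sigma>"
      using incl_surj[OF S.inv_closed[OF incl_closed[OF \<sigma>]]] by blast
    then have "recurrent_mult G \<tau> \<sigma> = \<one>\<^bsub>recurrent_group G\<^esub>"
      using \<sigma>
      by (intro incl_inj)
        (simp_all add: incl_mult recurrent_mult_closed incl_closed recurrent_one)
    with \<tau>(1) show "\<exists>\<tau>\<in>recurrent_configs G. recurrent_mult G \<tau> \<sigma> = \<one>\<^bsub>recurrent_group G\<^esub>"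
      by blast
  qed (simp_all add: recurrent_mult_closed recurrent_one,
      simp add: recurrent_mult_def add_configs_commute)
qed

end

theorem corollary2p16:
  fixes G :: "('a, 'b) pre_digraph" and s :: 'a
  assumes "fin_digraph G"
    and "global_sink G s"
  shows "comm_group (recurrent_group G) \<and>
    (\<lambda>\<sigma>. laplacian_row_span G #>\<^bsub>int_vectors G\<^esub> \<sigma>) \<in> iso (recurrent_group G) (sandpile_group G)"
proof -
  interpret sandpile G s
    using assms by (simp add: sandpile_def sandpile_axioms_def)
  show ?thesis
    using comm_group_recurrent incl_iso by blast
qed

end
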